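(* Let $L$ be the set of nonzero limit ordinals $\alpha<\omega_1$. For each $\alpha\in L$ let $x_\alpha:\omega\to\alpha$ be a non-decreasing function with $\alpha=\sup\{x_\alpha(n):n\in\omega\}$. Let $X=\{x_\alpha:\alpha\in L\}$, topologized by taking as a base all the sets $$B(\alpha,n)=\{x_\beta:\beta\in L,\ \beta\le\alpha,\ x_\beta\restriction n=x_\alpha\restriction n\},\qquad \alpha\in L,\ n\in\omega.$$ Then $X$ (Pol's space) is a $D$-space.
   Context: Here $x\restriction n$ denotes the restriction of $x$ to $n=\{0,\dots,n-1\}$. A neighborhood assignment on a space $Y$ is a family $\{N(y):y\in Y\}$ of subsets of $Y$ with $y\in \operatorname{Int} N(y)$ for each $y\in Y$. A space $Y$ is a $D$-space if for every neighborhood assignment $\{N(y):y\in Y\}$ on $Y$ there is a closed discrete subset $D$ of $Y$ such that $Y=\bigcup\{N(y):y\in D\}$. *)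

theory Defs
  imports "HOL-Analysis.Analysis" "HOL-Library.Countable_Set_Type" "HOL-Library.Lub_Glb"
begin

text \<open>The countable ordinals, as the field of the initial well-order of the cardinal
  successor of \<open>\<aleph>\<^sub>0\<close>. The type itself represents \<open>\<omega>\<^sub>1\<close>, and an element \<open>\<alpha>\<close>, seen as a set
  of ordinals, is \<open>{..<\<alpha>}\<close>.\<close>

typedef omega1 = "Field (cardSuc natLeq)"
proof -
  have "Field (cardSuc natLeq) \<noteq> {}"
    using cardSuc_finite[OF natLeq_Card_order] infinite_UNIV_nat
    by (metis Field_natLeq finite.emptyI)
  then show ?thesis by blast
qed

instantiation omega1 :: wellorder
begin

definition less_eq_omega1 :: "omega1 \<Rightarrow> omega1 \<Rightarrow> bool" where
  "\<alpha> \<le> \<beta> \<longleftrightarrow> (Rep_omega1 \<alpha>, Rep_omega1 \<beta>) \<in> cardSuc natLeq"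

definition less_omega1 :: "omega1 \<Rightarrow> omega1 \<Rightarrow> bool" where
  "\<alpha> < \<beta> \<longleftrightarrow> \<alpha> \<le> \<beta> \<and> \<not> \<beta> \<le> (\<alpha> :: omega1)"

instance
proof -
  let ?r = "cardSuc natLeq"
  have wo: "Well_order ?r"
    by (rule cardSuc_Well_order[OF natLeq_Card_order])
  then have lin: "Linear_order ?r" and wf: "wf (?r - Id)"
    by (auto simp: well_order_on_def)
  from lin have refl: "refl_on (Field ?r) ?r" and trans: "trans ?r" and antisym: "antisym ?r"
    and tot: "total_on (Field ?r) ?r"
    by (auto simp: order_on_defs)
  show "OFCLASS(omega1, wellorder_class)"
  proof
    fix \<alpha> \<beta> \<gamma> :: omega1
    show "\<alpha> < \<beta> \<longleftrightarrow> \<alpha> \<le> \<beta> \<and> \<not> \<beta> \<le> \<alpha>" by (rule less_omega1_def)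
    show r: "\<alpha> \<le> \<alpha>" for \<alpha> :: omega1
      using refl Rep_omega1 by (auto simp: less_eq_omega1_def refl_on_def)
    show "\<alpha> \<le> \<beta> \<Longrightarrow> \<beta> \<le> \<gamma> \<Longrightarrow> \<alpha> \<le> \<gamma>"
      unfolding less_eq_omega1_def by (rule transD[OF trans])
    show as: "\<alpha> \<le> \<beta> \<Longrightarrow> \<beta> \<le> \<alpha> \<Longrightarrow> \<alpha> = \<beta>" for \<alpha> \<beta> :: omega1
      unfolding less_eq_omega1_def
      by (rule iffD1[OF Rep_omega1_inject]) (rule antisymD[OF antisym])
    show "\<alpha> \<le> \<beta> \<or> \<beta> \<le> \<alpha>"
    proof (cases "\<alpha> = \<beta>")
      case True
      then show ?thesis using r by simp
    next
      case False
      then have "Rep_omega1 \<alpha> \<noteq> Rep_omega1 \<beta>" by (simp add: Rep_omega1_inject)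
      then show ?thesis
        unfolding less_eq_omega1_def
        by (rule tot[unfolded total_on_def, rule_format, OF Rep_omega1 Rep_omega1])
    qed
    show "P \<delta>" if step: "\<And>\<epsilon>. (\<And>\<eta>. \<eta> < \<epsilon> \<Longrightarrow> P \<eta>) \<Longrightarrow> P \<epsilon>" for P :: "omega1 \<Rightarrow> bool" and \<delta>
    proof -
      have wf': "wf (inv_image (?r - Id) Rep_omega1)" using wf by (rule wf_inv_image)
      show ?thesis
      proof (induction \<delta> rule: wf_induct_rule[OF wf'])
        case (1 \<epsilon>)
        show ?case
        proof (rule step)
          fix \<eta> assume "\<eta> < \<epsilon>"
          then have "(\<eta>, \<epsilon>) \<in> inv_image (?r - Id) Rep_omega1"
            by (auto simp: less_omega1_def less_eq_omega1_def inv_image_def)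
          then show "P \<eta>" by (rule 1)
        qed
      qed
    qed
  qed
qed

end

lemma uncountable_omega1:
  includes cardinal_syntax
  shows "uncountable (UNIV :: omega1 set)"
proof
  assume "countable (UNIV :: omega1 set)"
  then have "countable (range Rep_omega1)" by simp
  then have "|Field (cardSuc natLeq)| \<le>o natLeq"
    by (simp add: countable_card_le_natLeq type_definition.Rep_range[OF type_definition_omega1])
  then have "cardSuc natLeq \<le>o natLeq"
    using card_of_Field_ordIso[OF cardSuc_Card_order[OF natLeq_Card_order]]
      ordIso_ordLeq_trans ordIso_symmetric by blast
  then show False
    using cardSuc_greater[OF natLeq_Card_order] not_ordLess_ordLeq by blast
qed

lemma countable_lessThan_omega1:
  includes cardinal_syntax
  shows "countable {..<\<alpha> :: omega1}"
proof -
  have "|underS (cardSuc natLeq) (Rep_omega1 \<alpha>)| <o cardSuc natLeq"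
    by (rule card_of_underS[OF cardSuc_Card_order[OF natLeq_Card_order] Rep_omega1])
  then have "|underS (cardSuc natLeq) (Rep_omega1 \<alpha>)| \<le>o natLeq"
    by (simp add: cardSuc_ordLeq_ordLess[OF natLeq_Card_order card_of_Card_order])
  then have "countable (underS (cardSuc natLeq) (Rep_omega1 \<alpha>))"
    by (simp add: countable_card_le_natLeq)
  moreover have "Rep_omega1 ` {..<\<alpha>} \<subseteq> underS (cardSuc natLeq) (Rep_omega1 \<alpha>)"
    by (auto simp: underS_def less_le less_eq_omega1_def Rep_omega1_inject)
  ultimately have "countable (Rep_omega1 ` {..<\<alpha>})"
    by (rule countable_subset[rotated])
  then show ?thesis
    by (rule countable_image_inj_on) (simp add: inj_on_def Rep_omega1_inject)
qed

definition nonzero_limits :: "omega1 set" where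
  "nonzero_limits = {\<alpha>. (\<exists>\<beta>. \<beta> < \<alpha>) \<and> (\<forall>\<beta><\<alpha>. \<exists>\<gamma>. \<beta> < \<gamma> \<and> \<gamma> < \<alpha>)}"

definition pol_basic :: "(omega1 \<Rightarrow> nat \<Rightarrow> omega1) \<Rightarrow> omega1 \<Rightarrow> nat \<Rightarrow> (nat \<Rightarrow> omega1) set" where
  "pol_basic x \<alpha> n =
     {x \<beta> | \<beta>. \<beta> \<in> nonzero_limits \<and> \<beta> \<le> \<alpha> \<and> restrict (x \<beta>) {..<n} = restrict (x \<alpha>) {..<n}}"

text \<open>By lemma \<open>openin_pol_space\<close> below, under the hypotheses on \<open>x\<close> the argument of
  \<open>topology\<close> is indeed a topology.\<close>

definition pol_space :: "(omega1 \<Rightarrow> nat \<Rightarrow> omega1) \<Rightarrow> (nat \<Rightarrow> omega1) topology" where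
  "pol_space x =
     topology (arbitrary union_of (\<lambda>U. \<exists>\<alpha>\<in>nonzero_limits. \<exists>n. U = pol_basic x \<alpha> n))"

lemma openin_pol_space:
  assumes lub: "\<And>\<alpha>. \<alpha> \<in> nonzero_limits \<Longrightarrow> isLub UNIV (range (x \<alpha>)) \<alpha>"
  shows "openin (pol_space x) =
     arbitrary union_of (\<lambda>U. \<exists>\<alpha>\<in>nonzero_limits. \<exists>n. U = pol_basic x \<alpha> n)"
proof -
  let ?P = "\<lambda>U. \<exists>\<alpha>\<in>nonzero_limits. \<exists>n. U = pol_basic x \<alpha> n"
  have inj: "\<alpha> = \<beta>" if "\<alpha> \<in> nonzero_limits" "\<beta> \<in> nonzero_limits" "x \<alpha> = x \<beta>" for \<alpha> \<beta>
    using lub[OF that(1)] lub[OF that(2)] that(3)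
    by (auto simp: isLub_def leastP_def isUb_def setge_def intro: order.antisym)
  have "(arbitrary union_of ?P) (S \<inter> T)" if PS: "?P S" and PT: "?P T" for S T
  proof -
    from PS PT obtain \<alpha> n \<beta> m where
      S: "S = pol_basic x \<alpha> n" and T: "T = pol_basic x \<beta> m" by blast
    have "\<exists>U. ?P U \<and> p \<in> U \<and> U \<subseteq> S \<inter> T" if p: "p \<in> S \<inter> T" for p
    proof -
      from p obtain \<gamma> where g: "\<gamma> \<in> nonzero_limits" "p = x \<gamma>" "\<gamma> \<le> \<alpha>"
        "restrict (x \<gamma>) {..<n} = restrict (x \<alpha>) {..<n}"
        unfolding S pol_basic_def by auto
      from p obtain \<delta> where d: "\<delta> \<in> nonzero_limits" "p = x \<delta>" "\<delta> \<le> \<beta>"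
        "restrict (x \<delta>) {..<m} = restrict (x \<beta>) {..<m}"
        unfolding T pol_basic_def by auto
      have gd: "\<delta> = \<gamma>" using inj d g by metis
      have res: "restrict f {..<k} = restrict h {..<k} \<longleftrightarrow> (\<forall>i<k. f i = h i)"
        for f h :: "nat \<Rightarrow> omega1" and k
        by (auto simp: restrict_def fun_eq_iff)
      have "pol_basic x \<gamma> (max n m) \<subseteq> S \<inter> T"
      proof
        fix q assume "q \<in> pol_basic x \<gamma> (max n m)"
        then obtain \<epsilon> where e: "q = x \<epsilon>" "\<epsilon> \<in> nonzero_limits" "\<epsilon> \<le> \<gamma>"
          "\<forall>i<max n m. x \<epsilon> i = x \<gamma> i"
          unfolding pol_basic_def res by blast
        have "\<epsilon> \<le> \<alpha>" "\<epsilon> \<le> \<beta>"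
          using e(3) g(3) d(3) gd by auto
        moreover have "\<forall>i<n. x \<epsilon> i = x \<alpha> i" "\<forall>i<m. x \<epsilon> i = x \<beta> i"
          using e(4) g(4) d(4) unfolding gd res by auto
        ultimately show "q \<in> S \<inter> T"
          using e(1,2) unfolding S T pol_basic_def res by blast
      qed
      moreover have "p \<in> pol_basic x \<gamma> (max n m)"
        using g unfolding pol_basic_def by auto
      ultimately show ?thesis using g(1) by blast
    qed
    then show ?thesis unfolding arbitrary_union_of_alt by blast
  qed
  then have "istopology (arbitrary union_of ?P)"
    unfolding istopology_base_eq by (intro allI impI) (elim conjE, blast)
  then show ?thesis
    unfolding pol_space_def by (rule topology_inverse')
qed

lemma topspace_pol_space:
  assumes "\<And>\<alpha>. \<alpha> \<in> nonzero_limits \<Longrightarrow> isLub UNIV (range (x \<alpha>)) \<alpha>"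
  shows "topspace (pol_space x) = x ` nonzero_limits"
proof
  have op: "openin (pol_space x) =
     arbitrary union_of (\<lambda>U. \<exists>\<alpha>\<in>nonzero_limits. \<exists>n. U = pol_basic x \<alpha> n)"
    using assms by (rule openin_pol_space)
  show "topspace (pol_space x) \<subseteq> x ` nonzero_limits"
  proof -
    have "(arbitrary union_of (\<lambda>U. \<exists>\<alpha>\<in>nonzero_limits. \<exists>n. U = pol_basic x \<alpha> n))
        (topspace (pol_space x))"
      using op openin_topspace by metis
    then show ?thesis
      unfolding arbitrary_union_of_alt by (fastforce simp: pol_basic_def)
  qed
  show "x ` nonzero_limits \<subseteq> topspace (pol_space x)"
  proof
    fix p assume "p \<in> x ` nonzero_limits"
    then obtain \<alpha> where a: "\<alpha> \<in> nonzero_limits" "p = x \<alpha>" by blast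
    have "openin (pol_space x) (pol_basic x \<alpha> 0)"
      unfolding op using a(1) by (intro arbitrary_union_of_inc) blast
    moreover have "p \<in> pol_basic x \<alpha> 0" using a by (auto simp: pol_basic_def)
    ultimately show "p \<in> topspace (pol_space x)" using openin_subset by blast
  qed
qed

definition neighborhood_assignment :: "'a topology \<Rightarrow> ('a \<Rightarrow> 'a set) \<Rightarrow> bool" where
  "neighborhood_assignment Y N \<longleftrightarrow>
     (\<forall>y\<in>topspace Y. N y \<subseteq> topspace Y \<and> y \<in> Y interior_of N y)"

definition D_space :: "'a topology \<Rightarrow> bool" where
  "D_space Y \<longleftrightarrow>
     (\<forall>N. neighborhood_assignment Y N \<longrightarrow>
        (\<exists>D. closedin Y D \<and> subtopology Y D = discrete_topology D \<and>
             topspace Y = (\<Union>y\<in>D. N y)))"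

end

theory Submission
  imports Defs
begin
text \<open>
  Index points by ordinals: let \<open>\<gamma>\<close> stand for \<open>x \<gamma>\<close>. Shrinking a neighborhood assignment, one may
  assume that the neighborhood of \<open>\<alpha>\<close> is the basic set of all limits \<open>\<beta> \<le> \<alpha>\<close> whose sequences
  agree with that of \<open>\<alpha>\<close> below a radius \<open>r \<alpha>\<close>. The space is \<open>T\<^sub>1\<close>, so a set that meets some basic
  neighborhood of every point in a finite set is closed and discrete.

  Sort the points by the finite sequence \<open>s\<close> that determines their neighborhood: the cell of \<open>s\<close>
  consists of the \<open>\<alpha>\<close> whose first \<open>r \<alpha>\<close> values form \<open>s\<close>. A member \<open>\<alpha>\<close> of that cell covers all
  points up to \<open>\<alpha>\<close> whose sequences extend \<open>s\<close>. Hence an unbounded, equivalently uncountable, subset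
  of the cell covers the whole open set of points that extend \<open>s\<close>. The proof treats separately the
  closed set of \<^emph>\<open>thin\<close> points, none of whose initial segments has an uncountable cell.

  On the thin points, the map \<open>\<gamma> \<mapsto> x \<gamma> (r \<gamma>)\<close> is regressive and has countable fibres. This is the
  situation that Fodor's lemma excludes on stationary sets: some closed unbounded set misses all
  thin points. It cuts them into countable pieces, each of which has a closed discrete cover chosen
  greedily (\<open>countable_greedy_cover\<close>). The pieces do not interfere: a point of one piece has a
  neighborhood that contains thin points of its own piece only, and a point that is not thin has a
  neighborhood without thin points. This gives \<open>thin_cover\<close>, a set \<open>D\<close> of thin points.

  Every other point has a shortest initial segment \<open>s\<close> with an uncountable cell. Either the
  neighborhoods of \<open>D\<close> already cover all points extending \<open>s\<close>, or uncountably many members of the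
  cell are left uncovered. In the second case the suprema condition makes some coordinate take
  uncountably many values on them, and one member for each value gives an uncountable set whose
  members are told apart by one coordinate, hence closed and discrete. The extensions of different
  \<open>s\<close> are disjoint open sets, and an accumulation point outside all of them would be thin, hence in
  the open set covered by \<open>D\<close>, which the new points avoid. So all these sets together are still closed
  and discrete (\<open>cover_uncovered\<close>), and adding them to \<open>D\<close> finishes the proof.
\<close>

section \<open>Countable ordinals\<close>

lemma countable_atMost_omega1: "countable {..\<alpha> :: omega1}"
proof -
  have "{..\<alpha>} = insert \<alpha> {..<\<alpha>}" by auto
  then show ?thesis by (simp add: countable_lessThan_omega1)
qed

lemma countable_omega1_bounded:
  fixes A :: "omega1 set"
  assumes "countable A"
  shows "\<exists>\<beta>. \<forall>\<alpha>\<in>A. \<alpha> < \<beta>"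
proof (rule ccontr)
  assume "\<nexists>\<beta>. \<forall>\<alpha>\<in>A. \<alpha> < \<beta>"
  then have "UNIV = (\<Union>\<alpha>\<in>A. {..\<alpha>})" by (auto simp: not_less)
  moreover have "countable (\<Union>\<alpha>\<in>A. {..\<alpha>})"
    using assms by (intro countable_UN countable_atMost_omega1)
  ultimately show False using uncountable_omega1 by metis
qed

lemma uncountable_omega1_unbounded:
  fixes A :: "omega1 set"
  assumes "uncountable A"
  obtains \<alpha> where "\<alpha> \<in> A" "\<beta> < \<alpha>"
proof -
  have "\<not> A \<subseteq> {..\<beta>}"
    using assms countable_subset[OF _ countable_atMost_omega1] by metis
  then obtain \<alpha> where "\<alpha> \<in> A" "\<not> \<alpha> \<le> \<beta>" by auto
  then show ?thesis by (intro that[of \<alpha>]) auto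
qed

text \<open>Close off under \<open>h\<close> in \<open>\<omega>\<close> steps: below the least bound of the steps, every ordinal is already
  below some step, and the next step exceeds its image.\<close>
lemma unbounded_closed_under:
  fixes h :: "omega1 \<Rightarrow> omega1"
  shows "\<exists>\<gamma>>\<beta>. \<forall>\<delta><\<gamma>. h \<delta> < \<gamma>"
proof -
  have "\<exists>\<eta>. \<forall>\<alpha>\<in>insert \<delta> (h ` {..\<delta>}). \<alpha> < \<eta>" for \<delta>
    by (rule countable_omega1_bounded) (simp add: countable_atMost_omega1)
  then obtain step where "\<forall>\<delta>. \<forall>\<alpha>\<in>insert \<delta> (h ` {..\<delta>}). \<alpha> < step \<delta>"
    by metis
  then have step: "\<delta> < step \<delta>" "\<And>\<alpha>. \<alpha> \<le> \<delta> \<Longrightarrow> h \<alpha> < step \<delta>" for \<delta>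
    by auto
  define e where "e k = (step ^^ k) \<beta>" for k
  have "\<exists>\<gamma>. \<forall>\<alpha>\<in>range e. \<alpha> < \<gamma>" by (rule countable_omega1_bounded) simp
  then have ex: "\<exists>\<gamma>. \<forall>k. e k < \<gamma>" by auto
  define \<gamma> where "\<gamma> = (LEAST \<gamma>. \<forall>k. e k < \<gamma>)"
  have e_less: "e k < \<gamma>" for k using LeastI_ex[OF ex] unfolding \<gamma>_def ..
  have "h \<delta> < \<gamma>" if "\<delta> < \<gamma>" for \<delta>
  proof -
    have "\<not> (\<forall>k. e k < \<delta>)" using that unfolding \<gamma>_def by (rule not_less_Least)
    then obtain k where "\<delta> \<le> e k" by (auto simp: not_less)
    then have "h \<delta> < e (Suc k)" using step(2) by (simp add: e_def)
    then show ?thesis using e_less by (rule less_trans)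
  qed
  moreover have "\<beta> < \<gamma>" using e_less[of 0] by (simp add: e_def)
  ultimately show ?thesis by blast
qed

text \<open>A form of the converse of Fodor's lemma. Let \<open>h \<delta>\<close> bound the fibre of \<open>p\<close> over \<open>\<delta>\<close>. An ordinal
  closed under \<open>h\<close> cannot lie in an interval \<open>{p \<gamma><..\<gamma>}\<close> with \<open>\<gamma> \<in> S\<close>, because it would exceed
  \<open>h (p \<gamma>)\<close> and therefore \<open>\<gamma>\<close>. So the map to the next closed ordinal is constant on such intervals.\<close>
lemma regressive_countable_fibres_partition:
  fixes p :: "omega1 \<Rightarrow> omega1" and S :: "omega1 set"
  assumes fibres: "\<And>\<delta>. countable {\<gamma>\<in>S. p \<gamma> = \<delta>}"
  obtains c :: "omega1 \<Rightarrow> omega1" where "\<And>\<beta>. countable {\<alpha>. c \<alpha> = \<beta>}"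
    and "\<And>\<gamma> \<alpha>. \<gamma> \<in> S \<Longrightarrow> p \<gamma> < \<alpha> \<Longrightarrow> \<alpha> \<le> \<gamma> \<Longrightarrow> c \<alpha> = c \<gamma>"
proof -
  have "\<exists>\<eta>. \<forall>\<gamma>\<in>{\<gamma>\<in>S. p \<gamma> = \<delta>}. \<gamma> < \<eta>" for \<delta>
    by (rule countable_omega1_bounded[OF fibres])
  then obtain h where "\<forall>\<delta>. \<forall>\<gamma>\<in>{\<gamma>\<in>S. p \<gamma> = \<delta>}. \<gamma> < h \<delta>"
    by metis
  then have h: "\<gamma> \<in> S \<Longrightarrow> \<gamma> < h (p \<gamma>)" for \<gamma>
    by blast
  define C where "C = {\<gamma>. \<forall>\<delta><\<gamma>. h \<delta> < \<gamma>}"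
  define c where "c \<alpha> = (LEAST \<gamma>. \<gamma> \<in> C \<and> \<alpha> < \<gamma>)" for \<alpha>
  have c: "c \<alpha> \<in> C \<and> \<alpha> < c \<alpha>" for \<alpha>
    unfolding c_def
  proof (rule LeastI_ex)
    show "\<exists>\<gamma>. \<gamma> \<in> C \<and> \<alpha> < \<gamma>"
      unfolding C_def using unbounded_closed_under[of \<alpha> h] by blast
  qed
  have c_least: "c \<alpha> \<le> \<gamma>" if "\<gamma> \<in> C" "\<alpha> < \<gamma>" for \<alpha> \<gamma>
    unfolding c_def by (rule Least_le) (use that in auto)
  show ?thesis
  proof
    fix \<beta>
    have "{\<alpha>. c \<alpha> = \<beta>} \<subseteq> {..<\<beta>}" using c by auto
    then show "countable {\<alpha>. c \<alpha> = \<beta>}"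
      by (rule countable_subset) (rule countable_lessThan_omega1)
  next
    fix \<gamma> \<alpha> assume *: "\<gamma> \<in> S" "p \<gamma> < \<alpha>" "\<alpha> \<le> \<gamma>"
    have "\<gamma> < c \<alpha>"
    proof (rule ccontr)
      assume "\<not> \<gamma> < c \<alpha>"
      moreover have "h (p \<gamma>) < c \<alpha>" using c[of \<alpha>] *(2) by (auto simp: C_def)
      ultimately show False using h[OF *(1)] by auto
    qed
    then have "c \<gamma> \<le> c \<alpha>" using c[of \<alpha>] by (intro c_least) auto
    moreover have "c \<alpha> \<le> c \<gamma>"
      using c[of \<gamma>] *(3) by (intro c_least) (auto intro: le_less_trans)
    ultimately show "c \<alpha> = c \<gamma>" by simp
  qed
qed

section \<open>Greedy covering of a countable set\<close>

text \<open>Run through \<open>I\<close> in increasing order and keep an index if no index kept earlier covers it,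
  where \<open>R m n\<close> says that \<open>m\<close> covers \<open>n\<close>.\<close>
function greedy :: "nat set \<Rightarrow> (nat \<Rightarrow> nat \<Rightarrow> bool) \<Rightarrow> nat \<Rightarrow> bool" where
  "greedy I R n \<longleftrightarrow> n \<in> I \<and> (\<forall>m\<in>{..<n}. greedy I R m \<longrightarrow> \<not> R m n)"
  by auto
termination by (relation "Wellfounded.measure (\<lambda>(_, _, n). n)") auto

declare greedy.simps [simp del]

text \<open>In an enumeration of \<open>K\<close> of order type \<open>\<omega>\<close>, no point chosen after \<open>d\<close> lies in \<open>N d\<close>, so only
  the finitely many points up to \<open>d\<close> can. For open \<open>N d\<close> this is what makes \<open>D\<close> locally finite.\<close>
lemma countable_greedy_cover:
  fixes N :: "'a \<Rightarrow> 'a set"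
  assumes "countable K" and refl: "\<And>k. k \<in> K \<Longrightarrow> k \<in> N k"
  shows "\<exists>D\<subseteq>K. K \<subseteq> (\<Union>d\<in>D. N d) \<and> (\<forall>d\<in>D. finite (D \<inter> N d))"
proof -
  obtain e :: "'a \<Rightarrow> nat" where inj: "inj_on e K"
    using \<open>countable K\<close> by (auto simp: countable_def)
  define R where "R m n \<longleftrightarrow> (\<exists>k\<in>K. \<exists>l\<in>K. e k = m \<and> e l = n \<and> l \<in> N k)" for m n
  have R_iff: "R (e k) (e l) \<longleftrightarrow> l \<in> N k" if "k \<in> K" "l \<in> K" for k l
    using that inj unfolding R_def by (metis inj_onD)
  define D where "D = {k\<in>K. greedy (e ` K) R (e k)}"
  have cover: "\<exists>d\<in>D. k \<in> N d" if k: "k \<in> K" for k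
  proof (cases "k \<in> D")
    case True
    then show ?thesis using refl k by blast
  next
    case False
    then obtain m where m: "greedy (e ` K) R m" "R m (e k)"
      using k greedy.simps[of "e ` K" R "e k"] unfolding D_def by auto
    then obtain d where "d \<in> K" "m = e d" by (auto simp: greedy.simps[of _ _ m])
    then show ?thesis using m R_iff k unfolding D_def by auto
  qed
  have fin: "finite (D \<inter> N d)" if d: "d \<in> D" for d
  proof -
    have "e ` (D \<inter> N d) \<subseteq> {..e d}"
    proof (intro image_subsetI, rule ccontr)
      fix k assume k: "k \<in> D \<inter> N d" "e k \<notin> {..e d}"
      then have "\<not> R (e d) (e k)"
        using d greedy.simps[of "e ` K" R "e k"] unfolding D_def by auto
      then show False using k d R_iff unfolding D_def by auto
    qed
    moreover have "inj_on e (D \<inter> N d)"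
      using inj by (rule inj_on_subset) (auto simp: D_def)
    ultimately show ?thesis
      using finite_imageD finite_subset finite_atMost by metis
  qed
  have "D \<subseteq> K" by (auto simp: D_def)
  moreover have "K \<subseteq> (\<Union>d\<in>D. N d)" using cover by (intro subsetI UN_iff[THEN iffD2])
  ultimately show ?thesis using fin by (intro exI[of _ D]) simp
qed

section \<open>Pol's space as a topology on the limit ordinals\<close>

locale ladder_system =
  fixes x :: "omega1 \<Rightarrow> nat \<Rightarrow> omega1"
  assumes ladder_less: "\<And>\<alpha> n. \<alpha> \<in> nonzero_limits \<Longrightarrow> x \<alpha> n < \<alpha>"
    and ladder_mono: "\<And>\<alpha>. \<alpha> \<in> nonzero_limits \<Longrightarrow> mono (x \<alpha>)"
    and ladder_lub: "\<And>\<alpha>. \<alpha> \<in> nonzero_limits \<Longrightarrow> isLub UNIV (range (x \<alpha>)) \<alpha>"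
begin

definition prefix :: "omega1 \<Rightarrow> nat \<Rightarrow> omega1 list" where
  "prefix \<alpha> n = map (x \<alpha>) [0..<n]"

lemma length_prefix [simp]: "length (prefix \<alpha> n) = n"
  by (simp add: prefix_def)

lemma prefix_eq_iff: "prefix \<alpha> n = prefix \<beta> n \<longleftrightarrow> (\<forall>i<n. x \<alpha> i = x \<beta> i)"
  by (auto simp: prefix_def)

lemma prefix_eq_mono: "prefix \<alpha> n = prefix \<beta> n \<Longrightarrow> m \<le> n \<Longrightarrow> prefix \<alpha> m = prefix \<beta> m"
  by (auto simp: prefix_eq_iff)

lemma ladder_least:
  assumes "\<alpha> \<in> nonzero_limits" "\<And>n. x \<alpha> n \<le> \<beta>"
  shows "\<alpha> \<le> \<beta>"
  using ladder_lub[OF assms(1)] assms(2)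
  by (auto simp: isLub_def leastP_def isUb_def setge_def setle_def)

lemma ladder_inj: "inj_on x nonzero_limits"
proof (rule inj_onI)
  have le: "\<alpha> \<le> \<beta>"
    if "\<alpha> \<in> nonzero_limits" "\<beta> \<in> nonzero_limits" "x \<alpha> = x \<beta>" for \<alpha> \<beta>
  proof (rule ladder_least[OF that(1)])
    show "x \<alpha> n \<le> \<beta>" for n
      unfolding that(3) using ladder_less[OF that(2)] by (rule less_imp_le)
  qed
  show "\<alpha> = \<beta>" if "\<alpha> \<in> nonzero_limits" "\<beta> \<in> nonzero_limits" "x \<alpha> = x \<beta>" for \<alpha> \<beta>
    using le[OF that] le[OF that(2,1)] that(3) by simp
qed

lemma ladder_separated:
  assumes "\<alpha> \<in> nonzero_limits" "\<beta> \<in> nonzero_limits" "\<alpha> \<noteq> \<beta>"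
  obtains n where "prefix \<alpha> n \<noteq> prefix \<beta> n"
proof -
  have "x \<alpha> \<noteq> x \<beta>" using ladder_inj assms by (auto dest: inj_onD)
  then obtain i where "x \<alpha> i \<noteq> x \<beta> i" by blast
  then have "prefix \<alpha> (Suc i) \<noteq> prefix \<beta> (Suc i)" by (auto simp: prefix_eq_iff)
  then show ?thesis by (rule that)
qed

text \<open>The index set of \<open>pol_basic x \<alpha> n\<close>. Since \<open>x\<close> is injective on the limits, the space can be
  studied through sets of ordinals.\<close>
definition basic :: "omega1 \<Rightarrow> nat \<Rightarrow> omega1 set" where
  "basic \<alpha> n = {\<beta>\<in>nonzero_limits. \<beta> \<le> \<alpha> \<and> prefix \<beta> n = prefix \<alpha> n}"

lemma pol_basic_eq: "pol_basic x \<alpha> n = x ` basic \<alpha> n"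
proof -
  have "restrict f {..<n} = restrict g {..<n} \<longleftrightarrow> (\<forall>i<n. f i = g i)"
    for f g :: "nat \<Rightarrow> omega1"
    by (auto simp: restrict_def fun_eq_iff)
  then show ?thesis unfolding pol_basic_def basic_def prefix_eq_iff by auto
qed

lemma self_mem_basic: "\<alpha> \<in> nonzero_limits \<Longrightarrow> \<alpha> \<in> basic \<alpha> n"
  by (simp add: basic_def)

lemma topspace_pol: "topspace (pol_space x) = x ` nonzero_limits"
  by (rule topspace_pol_space[OF ladder_lub])

lemma openin_pol:
  "openin (pol_space x) =
    arbitrary union_of (\<lambda>U. \<exists>\<alpha>\<in>nonzero_limits. \<exists>n. U = x ` basic \<alpha> n)"
  unfolding pol_basic_eq[symmetric] by (rule openin_pol_space) (rule ladder_lub)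

lemma image_mem_basic_iff:
  "\<beta> \<in> nonzero_limits \<Longrightarrow> x \<beta> \<in> x ` basic \<alpha> n \<longleftrightarrow> \<beta> \<in> basic \<alpha> n"
  using ladder_inj by (rule inj_on_image_mem_iff) (auto simp: basic_def)

lemma openin_basic: "\<alpha> \<in> nonzero_limits \<Longrightarrow> openin (pol_space x) (x ` basic \<alpha> n)"
  unfolding openin_pol
  by (intro arbitrary_union_of_inc) blast

lemma basic_subset_open:
  assumes "openin (pol_space x) U" "x \<alpha> \<in> U" "\<alpha> \<in> nonzero_limits"
  obtains n where "x ` basic \<alpha> n \<subseteq> U"
proof -
  obtain \<beta> n where b: "x \<alpha> \<in> x ` basic \<beta> n" "x ` basic \<beta> n \<subseteq> U"
    using assms(1,2)
    unfolding openin_pol arbitrary_union_of_alt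
    by blast
  then have "\<alpha> \<in> basic \<beta> n"
    using assms(3) by (simp add: image_mem_basic_iff)
  then have "basic \<alpha> n \<subseteq> basic \<beta> n" by (auto simp: basic_def)
  then have "x ` basic \<alpha> n \<subseteq> U" using b(2) by blast
  then show ?thesis by (rule that)
qed

lemma t1_space_pol: "t1_space (pol_space x)"
  unfolding t1_space_def
proof (intro ballI impI)
  fix p q assume "p \<in> topspace (pol_space x)" "q \<in> topspace (pol_space x)" "p \<noteq> q"
  then obtain \<alpha> \<beta> where ab: "\<alpha> \<in> nonzero_limits" "\<beta> \<in> nonzero_limits" "p = x \<alpha>" "q = x \<beta>"
    by (auto simp: topspace_pol)
  moreover obtain n where "prefix \<alpha> n \<noteq> prefix \<beta> n"
    using ladder_separated ab \<open>p \<noteq> q\<close> by metis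
  ultimately have "q \<notin> x ` basic \<alpha> n"
    by (auto simp: image_mem_basic_iff) (auto simp: basic_def)
  then show "\<exists>U. openin (pol_space x) U \<and> p \<in> U \<and> q \<notin> U"
    using openin_basic[OF ab(1), of n] self_mem_basic[OF ab(1), of n] ab(3) by blast
qed

text \<open>In a \<open>T\<^sub>1\<close> space every neighborhood of an accumulation point meets the set in infinitely many
  points, so here there are no accumulation points at all. Unlike closed discreteness itself, the
  hypothesis \<open>fin\<close> is easy to check for unions of pieces.\<close>
lemma locally_finite_closed_discrete:
  assumes "D \<subseteq> nonzero_limits"
    and fin: "\<And>\<gamma>. \<gamma> \<in> nonzero_limits \<Longrightarrow> \<exists>n. finite (D \<inter> basic \<gamma> n)"
  shows "closedin (pol_space x) (x ` D)"
    and "subtopology (pol_space x) (x ` D) = discrete_topology (x ` D)"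
proof -
  have "p \<notin> pol_space x derived_set_of (x ` D)" for p
  proof
    assume p: "p \<in> pol_space x derived_set_of (x ` D)"
    then have "p \<in> topspace (pol_space x)" by (auto simp: in_derived_set_of)
    then obtain \<gamma> where g: "\<gamma> \<in> nonzero_limits" "p = x \<gamma>" by (auto simp: topspace_pol)
    obtain n where n: "finite (D \<inter> basic \<gamma> n)" using fin g by blast
    have "x ` (D \<inter> basic \<gamma> n) = x ` D \<inter> x ` basic \<gamma> n"
      using ladder_inj assms(1) by (rule inj_on_image_Int) (auto simp: basic_def)
    then have "finite (x ` D \<inter> x ` basic \<gamma> n)"
      using n by (metis finite_imageI)
    moreover have "infinite (x ` D \<inter> x ` basic \<gamma> n)"
      using p t1_space_pol g openin_basic[OF g(1), of n] self_mem_basic[OF g(1), of n]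
      unfolding t1_space_derived_set_of_infinite_openin by auto
    ultimately show False by blast
  qed
  then have empty: "pol_space x derived_set_of (x ` D) = {}" by blast
  have "x ` D \<subseteq> topspace (pol_space x)" using assms(1) by (auto simp: topspace_pol)
  with empty show "closedin (pol_space x) (x ` D)"
    and "subtopology (pol_space x) (x ` D) = discrete_topology (x ` D)"
    by (simp_all add: closedin_contains_derived_set subtopology_eq_discrete_topology_eq)
qed

text \<open>If every coordinate took only countably many values on \<open>A\<close>, some \<open>\<delta>\<close> would bound all values of
  all sequences in \<open>A\<close>, hence also their suprema, which are the members of the unbounded set \<open>A\<close>.
  Then choose one member of \<open>A\<close> for each value of a coordinate with uncountably many.\<close>
lemma uncountable_spread_subset:
  assumes "uncountable A" "A \<subseteq> nonzero_limits"
  obtains D n where "D \<subseteq> A" "uncountable D" "inj_on (\<lambda>\<alpha>. x \<alpha> n) D"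
proof -
  have "\<exists>n. uncountable ((\<lambda>\<alpha>. x \<alpha> n) ` A)"
  proof (rule ccontr)
    assume "\<nexists>n. uncountable ((\<lambda>\<alpha>. x \<alpha> n) ` A)"
    then have "countable (\<Union>n. (\<lambda>\<alpha>. x \<alpha> n) ` A)" by auto
    then obtain \<delta> where "\<forall>\<eta>\<in>(\<Union>n. (\<lambda>\<alpha>. x \<alpha> n) ` A). \<eta> < \<delta>"
      using countable_omega1_bounded by meson
    then have d: "x \<alpha> n < \<delta>" if "\<alpha> \<in> A" for \<alpha> n
      using that by auto
    obtain \<alpha> where a: "\<alpha> \<in> A" "\<delta> < \<alpha>"
      using uncountable_omega1_unbounded assms(1) .
    have "\<alpha> \<le> \<delta>"
    proof (rule ladder_least)
      show "\<alpha> \<in> nonzero_limits" using a(1) assms(2) by blast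
      show "x \<alpha> n \<le> \<delta>" for n using d[OF a(1)] by (rule less_imp_le)
    qed
    then show False using a by simp
  qed
  then obtain n where n: "uncountable ((\<lambda>\<alpha>. x \<alpha> n) ` A)" by blast
  then obtain D where D: "D \<subseteq> A" "inj_on (\<lambda>\<alpha>. x \<alpha> n) D" "(\<lambda>\<alpha>. x \<alpha> n) ` A = (\<lambda>\<alpha>. x \<alpha> n) ` D"
    using subset_image_inj[of "(\<lambda>\<alpha>. x \<alpha> n) ` A" "\<lambda>\<alpha>. x \<alpha> n" A] by auto
  then have "uncountable D" using n by auto
  then show ?thesis by (intro that[of D n]) (use D in auto)
qed

end

section \<open>Covering by neighborhoods of prescribed radius\<close>

locale ladder_radius = ladder_system +
  fixes r :: "omega1 \<Rightarrow> nat"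
begin

definition nbhd :: "omega1 \<Rightarrow> omega1 set" where
  "nbhd \<alpha> = basic \<alpha> (r \<alpha>)"

text \<open>The points whose neighborhood is cut out by agreement with \<open>s\<close>, so that it is an initial
  piece of the set of all points extending \<open>s\<close>.\<close>
definition cell :: "omega1 list \<Rightarrow> omega1 set" where
  "cell s = {\<alpha>\<in>nonzero_limits. prefix \<alpha> (r \<alpha>) = s}"

definition thin :: "omega1 set" where
  "thin = {\<alpha>\<in>nonzero_limits. \<forall>n. countable (cell (prefix \<alpha> n))}"

text \<open>Of interest for points that are not thin; only for them is \<open>LEAST\<close> applied to a property that
  holds somewhere.\<close>
definition stem :: "omega1 \<Rightarrow> omega1 list" where
  "stem \<alpha> = prefix \<alpha> (LEAST n. uncountable (cell (prefix \<alpha> n)))"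

lemma basic_subset_nbhd: "\<gamma> \<in> nbhd \<delta> \<Longrightarrow> basic \<gamma> (r \<delta>) \<subseteq> nbhd \<delta>"
  by (auto simp: nbhd_def basic_def)

text \<open>By monotonicity \<open>x \<gamma> (r \<gamma>) = \<delta>\<close> bounds the first \<open>r \<gamma>\<close> values. So \<open>\<gamma>\<close> lies in the cell of one of
  the countably many finite sequences in \<open>{..\<delta>}\<close>, and this cell is countable as \<open>\<gamma>\<close> is thin.\<close>
lemma thin_fibre_countable: "countable {\<gamma>\<in>thin. x \<gamma> (r \<gamma>) = \<delta>}"
proof -
  have "{\<gamma>\<in>thin. x \<gamma> (r \<gamma>) = \<delta>} \<subseteq> (\<Union>s\<in>{s\<in>lists {..\<delta>}. countable (cell s)}. cell s)"
  proof
    fix \<gamma> assume "\<gamma> \<in> {\<gamma>\<in>thin. x \<gamma> (r \<gamma>) = \<delta>}"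
    then have g: "\<gamma> \<in> thin" "\<gamma> \<in> nonzero_limits" "x \<gamma> (r \<gamma>) = \<delta>"
      unfolding thin_def by blast+
    have "prefix \<gamma> (r \<gamma>) \<in> lists {..\<delta>}"
      using monoD[OF ladder_mono[OF g(2)], of _ "r \<gamma>"] unfolding g(3)[symmetric] prefix_def
      by auto
    moreover have "\<gamma> \<in> cell (prefix \<gamma> (r \<gamma>))" "countable (cell (prefix \<gamma> (r \<gamma>)))"
      using g(1,2) unfolding thin_def cell_def by blast+
    ultimately show "\<gamma> \<in> (\<Union>s\<in>{s\<in>lists {..\<delta>}. countable (cell s)}. cell s)" by blast
  qed
  moreover have "countable {s\<in>lists {..\<delta>}. countable (cell s)}"
    using countable_lists[OF countable_atMost_omega1] by (rule countable_subset[rotated]) auto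
  then have "countable (\<Union>s\<in>{s\<in>lists {..\<delta>}. countable (cell s)}. cell s)"
    by (rule countable_UN) simp
  ultimately show ?thesis by (rule countable_subset)
qed

text \<open>Choose greedily within each class of the partition by \<open>c\<close>. If \<open>\<gamma>\<close> is thin and \<open>\<alpha> \<le> \<gamma>\<close> agrees with
  \<open>\<gamma>\<close> up to and including coordinate \<open>r \<gamma>\<close>, then \<open>x \<gamma> (r \<gamma>) = x \<alpha> (r \<gamma>) < \<alpha>\<close>, which puts \<open>\<alpha>\<close> in the
  class of \<open>\<gamma>\<close>. Hence the choices made in other classes stay away from \<open>\<gamma>\<close>.\<close>
lemma thin_cover:
  obtains D where "D \<subseteq> thin" "thin \<subseteq> (\<Union>d\<in>D. nbhd d)"
    "\<And>\<gamma>. \<gamma> \<in> nonzero_limits \<Longrightarrow> \<exists>n. finite (D \<inter> basic \<gamma> n)"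
proof -
  obtain c :: "omega1 \<Rightarrow> omega1" where c: "\<And>\<beta>. countable {\<alpha>. c \<alpha> = \<beta>}"
    "\<And>\<gamma> \<alpha>. \<gamma> \<in> thin \<Longrightarrow> x \<gamma> (r \<gamma>) < \<alpha> \<Longrightarrow> \<alpha> \<le> \<gamma> \<Longrightarrow> c \<alpha> = c \<gamma>"
    by (rule regressive_countable_fibres_partition[OF thin_fibre_countable]) (rule that)
  define K where "K \<beta> = {\<alpha>\<in>thin. c \<alpha> = \<beta>}" for \<beta>
  have "\<exists>D\<subseteq>K \<beta>. K \<beta> \<subseteq> (\<Union>d\<in>D. nbhd d) \<and> (\<forall>d\<in>D. finite (D \<inter> nbhd d))" for \<beta>
  proof (rule countable_greedy_cover)
    show "countable (K \<beta>)" using c(1)[of \<beta>] by (rule countable_subset[rotated]) (auto simp: K_def)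
    show "k \<in> nbhd k" if "k \<in> K \<beta>" for k
      using that self_mem_basic by (auto simp: K_def thin_def nbhd_def)
  qed
  then obtain E where E: "\<And>\<beta>. E \<beta> \<subseteq> K \<beta>" "\<And>\<beta>. K \<beta> \<subseteq> (\<Union>d\<in>E \<beta>. nbhd d)"
    "\<And>\<beta> d. d \<in> E \<beta> \<Longrightarrow> finite (E \<beta> \<inter> nbhd d)" by metis
  show ?thesis
  proof
    show sub: "(\<Union>\<beta>. E \<beta>) \<subseteq> thin" using E(1) by (auto simp: K_def)
    show "thin \<subseteq> (\<Union>d\<in>(\<Union>\<beta>. E \<beta>). nbhd d)"
    proof
      fix \<gamma> assume "\<gamma> \<in> thin"
      then have "\<gamma> \<in> K (c \<gamma>)" by (simp add: K_def)
      then show "\<gamma> \<in> (\<Union>d\<in>(\<Union>\<beta>. E \<beta>). nbhd d)" using E(2)[of "c \<gamma>"] by blast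
    qed
    fix \<gamma> assume \<gamma>: "\<gamma> \<in> nonzero_limits"
    show "\<exists>n. finite ((\<Union>\<beta>. E \<beta>) \<inter> basic \<gamma> n)"
    proof (cases "\<gamma> \<in> thin")
      case False
      then obtain n where n: "uncountable (cell (prefix \<gamma> n))"
        using \<gamma> by (auto simp: thin_def)
      have "\<alpha> \<notin> basic \<gamma> n" if "\<alpha> \<in> thin" for \<alpha>
      proof
        assume "\<alpha> \<in> basic \<gamma> n"
        then have "prefix \<alpha> n = prefix \<gamma> n" by (simp add: basic_def)
        moreover have "countable (cell (prefix \<alpha> n))" using that by (simp add: thin_def)
        ultimately show False using n by simp
      qed
      then have "(\<Union>\<beta>. E \<beta>) \<inter> basic \<gamma> n = {}" using sub by blast
      then show ?thesis by (metis finite.emptyI)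
    next
      case True
      obtain d where d: "d \<in> E (c \<gamma>)" "\<gamma> \<in> nbhd d"
        using E(2)[of "c \<gamma>"] True by (auto simp: K_def)
      \<comment> \<open>\<open>Suc (r \<gamma>)\<close> confines the neighborhood to the class of \<open>\<gamma>\<close>, \<open>r d\<close> to the neighborhood of \<open>d\<close>.\<close>
      define n where "n = max (r d) (Suc (r \<gamma>))"
      have "(\<Union>\<beta>. E \<beta>) \<inter> basic \<gamma> n \<subseteq> E (c \<gamma>) \<inter> nbhd d"
      proof
        fix \<alpha> assume a: "\<alpha> \<in> (\<Union>\<beta>. E \<beta>) \<inter> basic \<gamma> n"
        then have pre: "prefix \<alpha> n = prefix \<gamma> n" "\<alpha> \<le> \<gamma>" "\<alpha> \<in> nonzero_limits"
          by (auto simp: basic_def)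
        then have "x \<gamma> (r \<gamma>) = x \<alpha> (r \<gamma>)" by (auto simp: prefix_eq_iff n_def)
        then have "x \<gamma> (r \<gamma>) < \<alpha>" using ladder_less pre(3) by simp
        then have "c \<alpha> = c \<gamma>" using c(2) True pre(2) by blast
        moreover obtain \<beta> where \<beta>: "\<alpha> \<in> E \<beta>" using a by blast
        then have "\<beta> = c \<alpha>" using E(1)[of \<beta>] by (auto simp: K_def)
        ultimately have "\<alpha> \<in> E (c \<gamma>)" using \<beta> by simp
        moreover have "\<alpha> \<in> basic \<gamma> (r d)"
          using pre prefix_eq_mono[OF pre(1), of "r d"] by (auto simp: basic_def n_def)
        ultimately show "\<alpha> \<in> E (c \<gamma>) \<inter> nbhd d" using basic_subset_nbhd[OF d(2)] by blast
      qed
      then show ?thesis using E(3)[OF d(1)] by (meson finite_subset)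
    qed
  qed
qed

lemma uncountable_cell_stem:
  assumes "\<alpha> \<in> nonzero_limits - thin"
  shows "uncountable (cell (stem \<alpha>))"
proof -
  have "\<exists>n. uncountable (cell (prefix \<alpha> n))" using assms by (auto simp: thin_def)
  then show ?thesis unfolding stem_def by (rule LeastI_ex)
qed

lemma prefix_length_stem: "prefix \<alpha> (length (stem \<alpha>)) = stem \<alpha>"
  by (simp add: stem_def)

text \<open>Distinct stems are incomparable, as each is the shortest of its kind: the sets of points
  extending them are disjoint.\<close>
lemma stem_cong:
  assumes "\<alpha> \<in> nonzero_limits - thin" "prefix \<beta> (length (stem \<alpha>)) = stem \<alpha>"
  shows "stem \<beta> = stem \<alpha>"
proof -
  define m where "m = (LEAST n. uncountable (cell (prefix \<alpha> n)))"
  have stem: "stem \<alpha> = prefix \<alpha> m" unfolding stem_def m_def ..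
  have eq: "prefix \<beta> m = prefix \<alpha> m" using assms(2) unfolding stem by simp
  have m: "uncountable (cell (prefix \<alpha> m))"
    using uncountable_cell_stem[OF assms(1)] unfolding stem .
  have "(LEAST n. uncountable (cell (prefix \<beta> n))) = m"
  proof (rule Least_equality)
    show "uncountable (cell (prefix \<beta> m))" using m eq by simp
    fix n assume n: "uncountable (cell (prefix \<beta> n))"
    show "m \<le> n"
    proof (rule ccontr)
      assume "\<not> m \<le> n"
      then have "prefix \<beta> n = prefix \<alpha> n" using prefix_eq_mono[OF eq, of n] by simp
      then have "uncountable (cell (prefix \<alpha> n))" using n by simp
      then have "m \<le> n" unfolding m_def by (rule Least_le)
      then show False using \<open>\<not> m \<le> n\<close> by simp
    qed
  qed
  then have "stem \<beta> = prefix \<beta> m" unfolding stem_def by simp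
  then show ?thesis using eq stem by simp
qed

lemma stem_cell:
  assumes "\<alpha> \<in> nonzero_limits - thin" "\<beta> \<in> cell (stem \<alpha>)"
  shows "stem \<beta> = stem \<alpha>"
proof -
  have "prefix \<beta> (r \<beta>) = stem \<alpha>" using assms(2) by (simp add: cell_def)
  then have "prefix \<beta> (length (stem \<alpha>)) = stem \<alpha>" by (metis length_prefix)
  then show ?thesis using stem_cong assms(1) by blast
qed

text \<open>Suppose only countably many members of the cell are uncovered. Then there is a covered member \<open>\<alpha>\<close>
  above \<open>\<gamma>\<close>, say in the neighborhood of \<open>d \<in> D\<close>. As \<open>d\<close> is thin, it does not extend the stem of \<open>\<gamma>\<close>,
  so its radius is less than the length of that stem. On such a short segment \<open>\<gamma>\<close> agrees with
  \<open>\<alpha>\<close>, and \<open>\<gamma>\<close> is covered by \<open>d\<close> too.\<close>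
lemma uncountable_uncovered_cell:
  assumes D: "D \<subseteq> thin" and \<gamma>: "\<gamma> \<in> nonzero_limits - thin" "\<gamma> \<notin> (\<Union>d\<in>D. nbhd d)"
  shows "uncountable (cell (stem \<gamma>) - (\<Union>d\<in>D. nbhd d))" (is "uncountable (_ - ?W)")
proof
  assume "countable (cell (stem \<gamma>) - ?W)"
  moreover have "uncountable (cell (stem \<gamma>))" using uncountable_cell_stem \<gamma>(1) .
  ultimately have "uncountable (cell (stem \<gamma>) \<inter> ?W)"
    by (metis Diff_Int2 Int_commute Int_Diff_Un countable_Un Int_absorb)
  then obtain \<alpha> where a: "\<alpha> \<in> cell (stem \<gamma>) \<inter> ?W" "\<gamma> < \<alpha>"
    by (rule uncountable_omega1_unbounded)
  then obtain d where d: "d \<in> D" "\<alpha> \<in> nbhd d" by blast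
  let ?n = "length (stem \<gamma>)"
  have "prefix \<alpha> (r \<alpha>) = stem \<gamma>" using a by (simp add: cell_def)
  then have pa: "prefix \<alpha> ?n = prefix \<gamma> ?n"
    by (metis length_prefix prefix_length_stem)
  have pd: "prefix \<alpha> (r d) = prefix d (r d)" "\<alpha> \<le> d"
    using d(2) by (auto simp: nbhd_def basic_def)
  have "r d < ?n"
  proof (rule ccontr)
    assume "\<not> r d < ?n"
    then have "prefix d ?n = prefix \<gamma> ?n"
      using prefix_eq_mono[OF pd(1), of ?n] pa by simp
    moreover have "countable (cell (prefix d ?n))"
      using D d(1) unfolding thin_def by blast
    ultimately have "countable (cell (stem \<gamma>))" by (simp add: prefix_length_stem)
    then show False using uncountable_cell_stem \<gamma>(1) by blast
  qed
  then have "prefix \<gamma> (r d) = prefix d (r d)"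
    using prefix_eq_mono[OF pa, of "r d"] pd(1) by simp
  then have "\<gamma> \<in> nbhd d"
    using \<gamma>(1) a(2) pd(2) by (auto simp: nbhd_def basic_def)
  then show False using \<gamma>(2) d(1) by blast
qed

text \<open>For each stem \<open>s\<close> of an uncovered point, take an uncountable set of uncovered members of the
  cell of \<open>s\<close> that a single coordinate \<open>m s\<close> tells apart; being unbounded, it covers all points
  extending \<open>s\<close>. A covered point has a neighborhood without any chosen point. An uncovered one has a
  neighborhood in which all points share its stem \<open>s\<close> and its coordinate \<open>m s\<close>, so at most one of
  them is chosen.\<close>
lemma cover_uncovered:
  assumes D: "D \<subseteq> thin" "thin \<subseteq> (\<Union>d\<in>D. nbhd d)"
  obtains E where "E \<subseteq> nonzero_limits" "nonzero_limits \<subseteq> (\<Union>d\<in>D\<union>E. nbhd d)"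
    "\<And>\<gamma>. \<gamma> \<in> nonzero_limits \<Longrightarrow> \<exists>n. finite (E \<inter> basic \<gamma> n)"
proof -
  define W where "W = (\<Union>d\<in>D. nbhd d)"
  have W_stem: "\<gamma> \<in> nonzero_limits - thin" if "\<gamma> \<in> nonzero_limits - W" for \<gamma>
    using that D(2) by (auto simp: W_def)
  define S where "S = stem ` (nonzero_limits - W)"
  have "\<exists>F n. F \<subseteq> cell s - W \<and> uncountable F \<and> inj_on (\<lambda>\<alpha>. x \<alpha> n) F" if s: "s \<in> S" for s
  proof -
    have "uncountable (cell s - W)"
      using s uncountable_uncovered_cell[OF D(1)] W_stem unfolding S_def W_def by blast
    moreover have "cell s - W \<subseteq> nonzero_limits" by (auto simp: cell_def)
    ultimately show ?thesis using uncountable_spread_subset by metis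
  qed
  then obtain F m where F: "\<And>s. s \<in> S \<Longrightarrow> F s \<subseteq> cell s - W"
    "\<And>s. s \<in> S \<Longrightarrow> uncountable (F s)" "\<And>s. s \<in> S \<Longrightarrow> inj_on (\<lambda>\<alpha>. x \<alpha> (m s)) (F s)"
    by metis
  have F_stem: "stem \<alpha> = s" if "s \<in> S" "\<alpha> \<in> F s" for \<alpha> s
    using that F(1) stem_cell W_stem unfolding S_def by blast
  show ?thesis
  proof
    show "(\<Union>s\<in>S. F s) \<subseteq> nonzero_limits" using F(1) by (fastforce simp: cell_def)
    show "nonzero_limits \<subseteq> (\<Union>d\<in>D \<union> (\<Union>s\<in>S. F s). nbhd d)"
    proof
      fix \<gamma> assume \<gamma>: "\<gamma> \<in> nonzero_limits"
      show "\<gamma> \<in> (\<Union>d\<in>D \<union> (\<Union>s\<in>S. F s). nbhd d)"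
      proof (cases "\<gamma> \<in> W")
        case True
        then show ?thesis by (auto simp: W_def)
      next
        case False
        then have s: "stem \<gamma> \<in> S" using \<gamma> by (auto simp: S_def)
        obtain \<alpha> where a: "\<alpha> \<in> F (stem \<gamma>)" "\<gamma> < \<alpha>"
          using F(2)[OF s] by (rule uncountable_omega1_unbounded)
        then have "prefix \<alpha> (r \<alpha>) = stem \<gamma>" using F(1)[OF s] by (auto simp: cell_def)
        then have "prefix \<gamma> (r \<alpha>) = prefix \<alpha> (r \<alpha>)"
          by (metis length_prefix prefix_length_stem)
        then have "\<gamma> \<in> nbhd \<alpha>" using a(2) \<gamma> by (auto simp: nbhd_def basic_def)
        then show ?thesis using a(1) s by blast
      qed
    qed
    fix \<gamma> assume \<gamma>: "\<gamma> \<in> nonzero_limits"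
    show "\<exists>n. finite ((\<Union>s\<in>S. F s) \<inter> basic \<gamma> n)"
    proof (cases "\<gamma> \<in> W")
      case True
      then obtain d where "d \<in> D" "\<gamma> \<in> nbhd d" by (auto simp: W_def)
      then have "basic \<gamma> (r d) \<subseteq> W" using basic_subset_nbhd by (fastforce simp: W_def)
      then have "(\<Union>s\<in>S. F s) \<inter> basic \<gamma> (r d) = {}" using F(1) by blast
      then show ?thesis by (metis finite.emptyI)
    next
      case False
      let ?s = "stem \<gamma>"
      have s: "?s \<in> S" using \<gamma> False by (auto simp: S_def)
      define n where "n = max (length ?s) (Suc (m ?s))"
      have sub: "(\<Union>s\<in>S. F s) \<inter> basic \<gamma> n \<subseteq> {\<alpha>\<in>F ?s. x \<alpha> (m ?s) = x \<gamma> (m ?s)}"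
      proof
        fix \<alpha> assume a: "\<alpha> \<in> (\<Union>s\<in>S. F s) \<inter> basic \<gamma> n"
        then have pre: "prefix \<alpha> n = prefix \<gamma> n" by (auto simp: basic_def)
        then have "prefix \<alpha> (length ?s) = prefix \<gamma> (length ?s)"
          using prefix_eq_mono[OF pre, of "length ?s"] by (simp add: n_def)
        then have "stem \<alpha> = ?s"
          using stem_cong W_stem \<gamma> False by (simp add: prefix_length_stem)
        then have "\<alpha> \<in> F ?s" using a F_stem by auto
        moreover have "x \<alpha> (m ?s) = x \<gamma> (m ?s)"
          using pre by (auto simp: prefix_eq_iff n_def)
        ultimately show "\<alpha> \<in> {\<alpha>\<in>F ?s. x \<alpha> (m ?s) = x \<gamma> (m ?s)}" by blast
      qed
      have "finite {\<alpha>\<in>F ?s. x \<alpha> (m ?s) = x \<gamma> (m ?s)}"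
      proof (rule finite_imageD)
        show "inj_on (\<lambda>\<alpha>. x \<alpha> (m ?s)) {\<alpha>\<in>F ?s. x \<alpha> (m ?s) = x \<gamma> (m ?s)}"
          using F(3)[OF s] by (rule inj_on_subset) auto
        show "finite ((\<lambda>\<alpha>. x \<alpha> (m ?s)) ` {\<alpha>\<in>F ?s. x \<alpha> (m ?s) = x \<gamma> (m ?s)})"
          by (rule finite_subset[of _ "{x \<gamma> (m ?s)}"]) auto
      qed
      then show ?thesis using sub finite_subset by blast
    qed
  qed
qed

lemma closed_discrete_cover:
  obtains D where "D \<subseteq> nonzero_limits" "nonzero_limits \<subseteq> (\<Union>d\<in>D. nbhd d)"
    "closedin (pol_space x) (x ` D)"
    "subtopology (pol_space x) (x ` D) = discrete_topology (x ` D)"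
proof -
  obtain D where D: "D \<subseteq> thin" "thin \<subseteq> (\<Union>d\<in>D. nbhd d)"
    "\<And>\<gamma>. \<gamma> \<in> nonzero_limits \<Longrightarrow> \<exists>n. finite (D \<inter> basic \<gamma> n)"
    by (rule thin_cover) (rule that)
  obtain E where E: "E \<subseteq> nonzero_limits" "nonzero_limits \<subseteq> (\<Union>d\<in>D\<union>E. nbhd d)"
    "\<And>\<gamma>. \<gamma> \<in> nonzero_limits \<Longrightarrow> \<exists>n. finite (E \<inter> basic \<gamma> n)"
    by (rule cover_uncovered[OF D(1,2)]) (rule that)
  have sub: "D \<union> E \<subseteq> nonzero_limits" using D(1) E(1) by (auto simp: thin_def)
  have fin: "\<exists>n. finite ((D \<union> E) \<inter> basic \<gamma> n)" if \<gamma>: "\<gamma> \<in> nonzero_limits" for \<gamma>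
  proof -
    obtain k l where kl: "finite (D \<inter> basic \<gamma> k)" "finite (E \<inter> basic \<gamma> l)"
      using D(3)[OF \<gamma>] E(3)[OF \<gamma>] by blast
    have "basic \<gamma> (max k l) \<subseteq> basic \<gamma> k" "basic \<gamma> (max k l) \<subseteq> basic \<gamma> l"
      by (auto simp: basic_def prefix_eq_iff)
    then have "(D \<union> E) \<inter> basic \<gamma> (max k l) \<subseteq> D \<inter> basic \<gamma> k \<union> E \<inter> basic \<gamma> l" by blast
    then have "finite ((D \<union> E) \<inter> basic \<gamma> (max k l))"
      using kl by (auto intro: finite_subset)
    then show ?thesis ..
  qed
  show ?thesis
    using that[OF sub E(2)] locally_finite_closed_discrete[OF sub] fin by blast
qed

end

theorem theorem5p1:
  fixes x :: "omega1 \<Rightarrow> nat \<Rightarrow> omega1"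
  assumes "\<And>\<alpha>. \<alpha> \<in> nonzero_limits \<Longrightarrow> range (x \<alpha>) \<subseteq> {..<\<alpha>}"
    and "\<And>\<alpha>. \<alpha> \<in> nonzero_limits \<Longrightarrow> mono (x \<alpha>)"
    and "\<And>\<alpha>. \<alpha> \<in> nonzero_limits \<Longrightarrow> isLub UNIV (range (x \<alpha>)) \<alpha>"
  shows "D_space (pol_space x)"
  unfolding D_space_def
proof (intro allI impI)
  fix N assume N: "neighborhood_assignment (pol_space x) N"
  interpret ladder_system x
    using assms by unfold_locales auto
  have "\<exists>n. x ` basic \<alpha> n \<subseteq> N (x \<alpha>)" if "\<alpha> \<in> nonzero_limits" for \<alpha>
  proof -
    have "x \<alpha> \<in> pol_space x interior_of N (x \<alpha>)"
      using N that by (auto simp: neighborhood_assignment_def topspace_pol)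
    then show ?thesis
      using basic_subset_open[OF openin_interior_of] interior_of_subset that by (metis subset_trans)
  qed
  then obtain r where r: "\<And>\<alpha>. \<alpha> \<in> nonzero_limits \<Longrightarrow> x ` basic \<alpha> (r \<alpha>) \<subseteq> N (x \<alpha>)" by metis
  interpret ladder_radius x r ..
  obtain D where D: "D \<subseteq> nonzero_limits" "nonzero_limits \<subseteq> (\<Union>d\<in>D. nbhd d)"
    "closedin (pol_space x) (x ` D)"
    "subtopology (pol_space x) (x ` D) = discrete_topology (x ` D)"
    by (rule closed_discrete_cover)
  have "topspace (pol_space x) = (\<Union>y\<in>x ` D. N y)"
  proof
    show "topspace (pol_space x) \<subseteq> (\<Union>y\<in>x ` D. N y)"
    proof
      fix p assume "p \<in> topspace (pol_space x)"
      then obtain \<gamma> where \<gamma>: "\<gamma> \<in> nonzero_limits" "p = x \<gamma>" by (auto simp: topspace_pol)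
      then obtain d where d: "d \<in> D" "\<gamma> \<in> nbhd d" using D(2) by blast
      then have "x \<gamma> \<in> N (x d)" using D(1) r[of d] by (auto simp: nbhd_def)
      then show "p \<in> (\<Union>y\<in>x ` D. N y)" using \<gamma>(2) d(1) by blast
    qed
    show "(\<Union>y\<in>x ` D. N y) \<subseteq> topspace (pol_space x)"
      using N D(1) unfolding neighborhood_assignment_def topspace_pol by blast
  qed
  then show "\<exists>D. closedin (pol_space x) D \<and> subtopology (pol_space x) D = discrete_topology D \<and>
      topspace (pol_space x) = (\<Union>y\<in>D. N y)"
    using D(3,4) by blast
qed

end
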